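(* Let $\lambda>0$ and let $b:\mathbb{R}\to\mathbb{R}^+$ be a continuous function satisfying $0<b_0\le b(t)\le b_1$ for all $t\in\mathbb{R}$. Let $U$ be the multivalued process on $\mathbb{R}$ generated by all solutions of the differential inclusion $$\frac{du}{dt}+\lambda u\in b(t)H_0(u),\ t\ge\tau,\qquad u(\tau)=u_\tau,$$ where $H_0(u)=\{1\}$ if $u>0$, $H_0(0)=[-1,1]$, $H_0(u)=\{-1\}$ if $u<0$. Let $\mathcal{A}=\{\mathcal{A}(t)\}_{t\in\mathbb{R}}$ be the pullback attractor of $U$. Then $\mathcal{A}$ is a forward attractor of $U$.
   Context: A solution on $[\tau,\infty)$ is a function $u\in C([\tau,\infty),\mathbb{R})$ with $\frac{du}{dt}\in L^\infty_{loc}([\tau,\infty),\mathbb{R})$ for which there is $h\in L^\infty_{loc}([\tau,\infty),\mathbb{R})$ with $h(t)\in H_0(u(t))$ and $\frac{du}{dt}+\lambda u=b(t)h(t)$ for a.a. $t\ge\tau$. $\mathcal{R}_\tau$ is the set of all solutions on $[\tau,\infty)$, and $U(t,\tau,x)=\{u(t):u\in\mathcal{R}_\tau,\ u(\tau)=x\}$, $U(t,\tau,B)=\bigcup_{x\in B}U(t,\tau,x)$. $dist(A,B)=\sup_{y\in A}\inf_{x\in B}|y-x|$. A family $\{K(t)\}$ is negatively invariant if $K(t)\subset U(t,s,K(s))$ for all $t\ge s$. The pullback attractor is the family of non-empty compact negatively invariant sets which is the minimal family of closed sets satisfying $dist(U(t,t_0,B),\mathcal{A}(t))\to0$ as $t_0\to-\infty$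 for every bounded $B\subset\mathbb{R}$ and every fixed $t$; it is known to exist here and that $\mathcal{A}(t)=[\xi_M^-(t),\xi_M^+(t)]$ with $\xi_M^{\pm}(t)=\pm\int_{-\infty}^te^{-\lambda(t-s)}b(s)\,ds$. A forward attractor is a family of non-empty compact negatively invariant sets with $dist(U(t,t_0,B),\mathcal{A}(t))\to0$ as $t\to+\infty$ for every bounded $B\subset\mathbb{R}$ and every fixed $t_0$. *)

theory Defs
  imports "HOL-Analysis.Analysis"
begin

definition H0 :: "real \<Rightarrow> real set" where
  "H0 u = (if u > 0 then {1} else if u = 0 then {-1..1} else {-1})"

definition Linf_loc :: "real set \<Rightarrow> (real \<Rightarrow> real) \<Rightarrow> bool" where
  "Linf_loc S f \<longleftrightarrow> f \<in> borel_measurable (lebesgue_on S) \<and>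
     (\<forall>K. compact K \<and> K \<subseteq> S \<longrightarrow> (\<exists>C. AE t in lebesgue_on K. \<bar>f t\<bar> \<le> C))"

text \<open>The class of test functions $C^\infty_c(\Omega)$, extended by zero to the whole line.\<close>

definition test_function :: "real set \<Rightarrow> (real \<Rightarrow> real) \<Rightarrow> bool" where
  "test_function \<Omega> \<phi> \<longleftrightarrow>
     (\<forall>n t. (deriv ^^ n) \<phi> differentiable (at t)) \<and>
     compact (closure {t. \<phi> t \<noteq> 0}) \<and> closure {t. \<phi> t \<noteq> 0} \<subseteq> \<Omega>"

definition weak_derivative :: "real set \<Rightarrow> (real \<Rightarrow> real) \<Rightarrow> (real \<Rightarrow> real) \<Rightarrow> bool" where
  "weak_derivative \<Omega> u v \<longleftrightarrow>
     (\<forall>\<phi>. test_function \<Omega> \<phi> \<longrightarrow>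
       (LINT t:\<Omega>|lebesgue. u t * deriv \<phi> t) = - (LINT t:\<Omega>|lebesgue. v t * \<phi> t))"

text \<open>
  A function on $[\tau,\infty)$ is represented by a total function of which only the values on
  \<open>{\<tau>..}\<close> matter. The derivative of a solution is a function \<open>v\<close> in $L^\infty_{loc}$, equal to
  $du/dt$ in the sense of distributions on the open half-line.
\<close>

definition solutions :: "real \<Rightarrow> (real \<Rightarrow> real) \<Rightarrow> real \<Rightarrow> (real \<Rightarrow> real) set" where
  "solutions lam b \<tau> = {u. continuous_on {\<tau>..} u \<and>
     (\<exists>v. Linf_loc {\<tau>..} v \<and> weak_derivative {\<tau><..} u v \<and>
       (\<exists>h. Linf_loc {\<tau>..} h \<and>
         (AE t in lebesgue_on {\<tau>..}. h t \<in> H0 (u t) \<and> v t + lam * u t = b t * h t)))}"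

text \<open>
  A multivalued process is a map taking \<open>t\<close>, \<open>\<tau>\<close>, \<open>x\<close> to the set $U(t,\tau,x)$;
  it is meaningful only for $t \ge \tau$.
\<close>

type_synonym mv_process = "real \<Rightarrow> real \<Rightarrow> real \<Rightarrow> real set"

definition process :: "real \<Rightarrow> (real \<Rightarrow> real) \<Rightarrow> mv_process" where
  "process lam b t \<tau> x = {u t | u. u \<in> solutions lam b \<tau> \<and> u \<tau> = x}"

definition process_set :: "mv_process \<Rightarrow> real \<Rightarrow> real \<Rightarrow> real set \<Rightarrow> real set" where
  "process_set U t \<tau> B = (\<Union>x\<in>B. U t \<tau> x)"

text \<open>
  The Hausdorff semidistance takes values in \<open>ennreal\<close>, so that the supremum and infimum always
  exist: it is \<open>\<infinity>\<close> if \<open>A\<close> is non-empty and \<open>B\<close> is empty, and \<open>0\<close> if \<open>A\<close> is empty.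
\<close>

definition semidist :: "real set \<Rightarrow> real set \<Rightarrow> ennreal" where
  "semidist A B = (SUP y\<in>A. INF x\<in>B. ennreal \<bar>y - x\<bar>)"

definition negatively_invariant :: "mv_process \<Rightarrow> (real \<Rightarrow> real set) \<Rightarrow> bool" where
  "negatively_invariant U K \<longleftrightarrow> (\<forall>s t. s \<le> t \<longrightarrow> K t \<subseteq> process_set U t s (K s))"

definition pullback_attracting :: "mv_process \<Rightarrow> (real \<Rightarrow> real set) \<Rightarrow> bool" where
  "pullback_attracting U K \<longleftrightarrow>
     (\<forall>B t. bounded B \<longrightarrow> ((\<lambda>t0. semidist (process_set U t t0 B) (K t)) \<longlongrightarrow> 0) at_bot)"

definition forward_attracting :: "mv_process \<Rightarrow> (real \<Rightarrow> real set) \<Rightarrow> bool" where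
  "forward_attracting U K \<longleftrightarrow>
     (\<forall>B t0. bounded B \<longrightarrow> ((\<lambda>t. semidist (process_set U t t0 B) (K t)) \<longlongrightarrow> 0) at_top)"

definition pullback_attractor :: "mv_process \<Rightarrow> (real \<Rightarrow> real set) \<Rightarrow> bool" where
  "pullback_attractor U A \<longleftrightarrow>
     (\<forall>t. A t \<noteq> {} \<and> compact (A t)) \<and> negatively_invariant U A \<and> pullback_attracting U A \<and>
     (\<forall>C. (\<forall>t. closed (C t)) \<and> pullback_attracting U C \<longrightarrow> (\<forall>t. A t \<subseteq> C t))"

definition forward_attractor :: "mv_process \<Rightarrow> (real \<Rightarrow> real set) \<Rightarrow> bool" where
  "forward_attractor U A \<longleftrightarrow>
     (\<forall>t. A t \<noteq> {} \<and> compact (A t)) \<and> negatively_invariant U A \<and> forward_attracting U A"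

end

theory Submission imports Defs begin

text \<open>
  Let \<open>G\<close> be an antiderivative of \<open>exp (lam * t) * b t\<close>. Since \<open>H0\<close> takes values in \<open>[-1, 1]\<close>, both
  \<open>exp (lam * t) * u t + G t\<close> and \<open>- exp (lam * t) * u t + G t\<close> are nondecreasing along every
  solution \<open>u\<close>. Hence \<open>u t\<close> lies within \<open>exp (- lam * (t - t0)) * \<bar>u t0\<bar>\<close> of the interval
  \<open>[-J, J]\<close> with \<open>J = exp (- lam * t) * (G t - G t0)\<close>. Every point of this interval is the value at \<open>t\<close>
  of a solution that stays at zero up to some time \<open>r \<ge> t0\<close> and may therefore be started at zero
  at any time before \<open>t0\<close>; so a closed pullback attracting family contains \<open>[-J, J]\<close>,
  and it attracts forwards at the rate \<open>exp (- lam * (t - t0))\<close>.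
\<close>

section \<open>Smooth functions of one variable\<close>

text \<open>Smoothness means this for every \<open>n\<close>. Quantifying over a derivative witness
  lets closure under sums, products and affine substitutions be proved by induction, with no
  iterated \<open>deriv\<close> to compute.\<close>

primrec times_differentiable :: "nat \<Rightarrow> (real \<Rightarrow> real) \<Rightarrow> bool" where
  "times_differentiable 0 f \<longleftrightarrow> True"
| "times_differentiable (Suc n) f \<longleftrightarrow>
     (\<exists>f'. (\<forall>x. (f has_real_derivative f' x) (at x)) \<and> times_differentiable n f')"

lemma times_differentiable_SucI:
  assumes "\<And>x. (f has_real_derivative f' x) (at x)" "times_differentiable n f'"
  shows "times_differentiable (Suc n) f"
  using assms by auto

lemma times_differentiable_Suc_imp: "times_differentiable (Suc n) f \<Longrightarrow> times_differentiable n f"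
  by (induction n arbitrary: f) (simp, metis times_differentiable.simps(2))

lemma times_differentiable_const: "times_differentiable n (\<lambda>x. c)"
proof (induction n arbitrary: c)
  case (Suc n)
  show ?case by (rule times_differentiable_SucI[OF _ Suc[of 0]]) simp
qed simp

lemma times_differentiable_add:
  "times_differentiable n f \<Longrightarrow> times_differentiable n g \<Longrightarrow> times_differentiable n (\<lambda>x. f x + g x)"
proof (induction n arbitrary: f g)
  case (Suc n)
  then obtain f' g' where
    "\<And>x. (f has_real_derivative f' x) (at x)" "times_differentiable n f'"
    "\<And>x. (g has_real_derivative g' x) (at x)" "times_differentiable n g'"
    by auto
  then show ?case
    by (intro times_differentiable_SucI[where f' = "\<lambda>x. f' x + g' x"] Suc.IH DERIV_add) auto
qed simp

lemma times_differentiable_mult: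
  "times_differentiable n f \<Longrightarrow> times_differentiable n g \<Longrightarrow> times_differentiable n (\<lambda>x. f x * g x)"
proof (induction n arbitrary: f g)
  case (Suc n)
  then obtain f' g' where
    "\<And>x. (f has_real_derivative f' x) (at x)" "times_differentiable n f'"
    "\<And>x. (g has_real_derivative g' x) (at x)" "times_differentiable n g'"
    by auto
  moreover have "times_differentiable n f" "times_differentiable n g"
    using Suc.prems by (blast intro: times_differentiable_Suc_imp)+
  ultimately show ?case
    by (intro times_differentiable_SucI[where f' = "\<lambda>x. f' x * g x + g' x * f x"] Suc.IH DERIV_mult
        times_differentiable_add) auto
qed simp

lemma times_differentiable_cmult: "times_differentiable n f \<Longrightarrow> times_differentiable n (\<lambda>x. c * f x)"
  by (intro times_differentiable_mult times_differentiable_const)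

lemma times_differentiable_diff:
  "times_differentiable n f \<Longrightarrow> times_differentiable n g \<Longrightarrow> times_differentiable n (\<lambda>x. f x - g x)"
  using times_differentiable_add[OF _ times_differentiable_cmult[of n g "-1"]] by simp

lemma times_differentiable_affine:
  "times_differentiable n f \<Longrightarrow> times_differentiable n (\<lambda>x. f (c * x + d))"
proof (induction n arbitrary: f)
  case (Suc n)
  then obtain f' where f': "\<And>x. (f has_real_derivative f' x) (at x)" "times_differentiable n f'"
    by auto
  have "((\<lambda>x. f (c * x + d)) has_real_derivative c * f' (c * x + d)) (at x)" for x
    by (rule DERIV_cong[OF DERIV_chain2[OF f'(1)]]) (auto intro!: derivative_eq_intros)
  then show ?case
    by (rule times_differentiable_SucI) (intro times_differentiable_cmult Suc.IH f'(2))
qed simp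

lemma times_differentiable_exp: "times_differentiable n (\<lambda>x. exp (c * x))"
proof (induction n)
  case (Suc n)
  have "((\<lambda>x. exp (c * x)) has_real_derivative c * exp (c * x)) (at x)" for x
    by (auto intro!: derivative_eq_intros)
  then show ?case
    by (rule times_differentiable_SucI) (intro times_differentiable_cmult Suc)
qed simp

text \<open>Bridge to the iterated \<open>deriv\<close> in \<open>test_function\<close>: each
  \<open>deriv\<close> uses up one order. The innermost one is peeled off first, so the induction
  must range over all \<open>f\<close>.\<close>

lemma times_differentiable_higher_deriv:
  "times_differentiable (m + n) f \<Longrightarrow> times_differentiable m ((deriv ^^ n) f)"
proof (induction n arbitrary: f)
  case (Suc n)
  then obtain f' where "\<And>x. (f has_real_derivative f' x) (at x)" "times_differentiable (m + n) f'"
    by auto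
  moreover from this have "deriv f = f'"
    by (intro ext DERIV_imp_deriv)
  ultimately show ?case
    using Suc.IH by (simp add: funpow_swap1)
qed simp

lemma higher_deriv_differentiable:
  assumes "\<And>n. times_differentiable n f"
  shows "(deriv ^^ n) f differentiable (at t)"
  using times_differentiable_higher_deriv[of "Suc 0" n f] assms[of "Suc 0 + n"] real_differentiable_def by auto

section \<open>Smooth bump functions built from \<open>exp (- (1 / x))\<close>\<close>

definition flat :: "nat \<Rightarrow> real \<Rightarrow> real" where
  "flat k x = (if x > 0 then (1 / x) ^ k * exp (- (1 / x)) else 0)"

lemma flat_nonneg: "0 \<le> flat k x"
  by (simp add: flat_def)

lemma flat_tendsto_0: "((flat k) \<longlongrightarrow> 0) (at 0)"
proof -
  have "((\<lambda>x::real. x ^ k / exp x) \<longlongrightarrow> 0) at_top"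
    by (rule tendsto_power_div_exp_0)
  then have "((\<lambda>x::real. (inverse x) ^ k / exp (inverse x)) \<longlongrightarrow> 0) (at_right 0)"
    by (rule filterlim_compose[OF _ filterlim_inverse_at_top_right])
  then have "(flat k \<longlongrightarrow> 0) (at_right 0)"
    by (rule Lim_transform_eventually)
       (auto simp: flat_def eventually_at_filter exp_minus divide_inverse)
  moreover have "(flat k \<longlongrightarrow> 0) (at_left 0)"
    by (rule tendsto_eventually) (auto simp: flat_def eventually_at_filter)
  ultimately show ?thesis
    by (simp add: filterlim_at_split)
qed

text \<open>The powers of \<open>1 / x\<close> are carried along so that the family
  \<open>flat k\<close> is closed under differentiation up to linear combinations; smoothness then
  follows by induction.\<close>

lemma flat_has_derivative:
  "(flat k has_real_derivative flat (k + 2) x - real k * flat (k + 1) x) (at x)"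
proof (cases x "0::real" rule: linorder_cases)
  case less
  have "((\<lambda>_. 0) has_real_derivative 0) (at x)"
    by simp
  then have "(flat k has_real_derivative 0) (at x)"
    by (rule has_field_derivative_transform_within_open[where S = "{..<0}"])
       (use less in \<open>auto simp: flat_def\<close>)
  then show ?thesis
    using less by (simp add: flat_def)
next
  case equal
  \<comment> \<open>Away from \<open>h = 0\<close> the difference quotient of \<open>flat k\<close>
    at zero is exactly \<open>flat (k + 1) h\<close>.\<close>
  have "((\<lambda>h. flat (k + 1) h) \<longlongrightarrow> 0) (at 0)"
    by (rule flat_tendsto_0)
  then have "((\<lambda>h. (flat k (0 + h) - flat k 0) / h) \<longlongrightarrow> 0) (at 0)"
    by (rule Lim_transform_eventually) (auto simp: flat_def eventually_at_filter)
  then show ?thesis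
    using equal by (simp add: DERIV_def) (simp add: flat_def)
next
  case greater
  \<comment> \<open>Substituting \<open>y = inverse x\<close> leaves only a power times an
    exponential to differentiate. For \<open>k = 0\<close> the truncated \<open>k - 1\<close> is
    harmless because its factor \<open>real k\<close> vanishes.\<close>
  define g where "g y = y ^ k * exp (- y)" for y :: real
  have "(g has_real_derivative (real k * y ^ (k - 1) - y ^ k) * exp (- y)) (at y)" for y
    unfolding g_def[abs_def] by (auto intro!: derivative_eq_intros simp: algebra_simps)
  from DERIV_chain2[OF this DERIV_inverse, of x UNIV]
  have "((\<lambda>x. g (inverse x)) has_real_derivative
      (real k * inverse x ^ (k - 1) - inverse x ^ k) * exp (- inverse x) * - (inverse x ^ 2)) (at x)"
    using greater by (simp add: numeral_2_eq_2)
  also have "(real k * inverse x ^ (k - 1) - inverse x ^ k) * exp (- inverse x) * - (inverse x ^ 2) =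
      flat (k + 2) x - real k * flat (k + 1) x"
    using greater by (cases k) (simp_all add: flat_def inverse_eq_divide[symmetric] algebra_simps power2_eq_square)
  finally have "((\<lambda>x. g (inverse x)) has_real_derivative flat (k + 2) x - real k * flat (k + 1) x) (at x)" .
  then show ?thesis
    by (rule has_field_derivative_transform_within_open[where S = "{0<..}"])
       (use greater in \<open>auto simp: flat_def g_def inverse_eq_divide\<close>)
qed

lemma times_differentiable_flat: "times_differentiable n (flat k)"
proof (induction n arbitrary: k)
  case (Suc n)
  show ?case
    by (rule times_differentiable_SucI[OF flat_has_derivative])
       (intro times_differentiable_diff times_differentiable_cmult Suc)
qed simp

lemma exists_bump:
  fixes d :: real
  assumes "0 < d"
  obtains \<beta> where "\<And>n. times_differentiable n \<beta>" "\<And>x. 0 \<le> \<beta> x" "\<And>x. 0 < \<beta> x \<longleftrightarrow> \<bar>x\<bar> < d"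
proof
  \<comment> \<open>The first factor is positive exactly for \<open>x > - d\<close>, the second
    exactly for \<open>x < d\<close>. The form \<open>1 * x + d\<close> matches
    \<open>times_differentiable_affine\<close>.\<close>
  let ?\<beta> = "\<lambda>x. flat 0 (1 * x + d) * flat 0 (- 1 * x + d)"
  show "times_differentiable n ?\<beta>" for n
    by (intro times_differentiable_mult times_differentiable_affine times_differentiable_flat)
  show "0 \<le> ?\<beta> x" for x
    by (intro mult_nonneg_nonneg flat_nonneg)
  show "0 < ?\<beta> x \<longleftrightarrow> \<bar>x\<bar> < d" for x
    using assms by (auto simp: flat_def zero_less_mult_iff)
qed

section \<open>Antiderivatives, supports and weak monotonicity\<close>

lemma exists_antiderivative:
  fixes f :: "real \<Rightarrow> real"
  assumes "continuous_on UNIV f"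
  obtains F where "\<And>x. (F has_real_derivative f x) (at x)"
proof -
  have "\<exists>F. \<forall>x::real. - \<infinity> < ereal x \<longrightarrow> ereal x < \<infinity> \<longrightarrow> (F has_vector_derivative f x) (at x)"
    using assms by (intro einterval_antiderivative) (auto simp: continuous_on_eq_continuous_at)
  then show thesis
    using that by (auto simp: has_real_derivative_iff_has_vector_derivative)
qed

lemma times_differentiable_imp_continuous_on:
  assumes "times_differentiable (Suc n) f"
  shows "continuous_on S f"
proof -
  obtain f' where "\<And>x. (f has_real_derivative f' x) (at x)"
    using assms by auto
  then show ?thesis
    by (intro continuous_at_imp_continuous_on) (blast intro: DERIV_isCont)
qed

lemma has_derivative_0_outside_support:
  fixes f :: "real \<Rightarrow> real"
  assumes "\<And>x. x \<notin> {a<..<b} \<Longrightarrow> f x = 0" "(f has_real_derivative D) (at x)" "x \<notin> {a..b}"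
  shows "D = 0"
proof -
  have "((\<lambda>_. 0) has_real_derivative 0) (at x)" 
    by simp
  then have "(f has_real_derivative 0) (at x)"
    by (rule has_field_derivative_transform_within_open[where S = "- {a..b}"])
       (use assms in \<open>auto simp: open_Compl\<close>)
  then show ?thesis
    using assms(2) DERIV_unique by blast
qed

text \<open>
  If \<open>F t < F s\<close>, the test function whose derivative is a bump at \<open>s\<close> minus the same bump
  at \<open>t\<close> gives a contradiction.
\<close>

lemma weakly_nondecreasing_imp_nondecreasing:
  fixes F :: "real \<Rightarrow> real"
  assumes cont: "continuous_on {\<tau><..} F"
    and weak: "\<And>\<psi> \<psi>' a b. (\<And>n. times_differentiable n \<psi>) \<Longrightarrow> (\<And>x. 0 \<le> \<psi> x) \<Longrightarrow>
      (\<And>x. (\<psi> has_real_derivative \<psi>' x) (at x)) \<Longrightarrow> \<tau> < a \<Longrightarrow> a < b \<Longrightarrow>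
      (\<And>x. x \<notin> {a<..<b} \<Longrightarrow> \<psi> x = 0) \<Longrightarrow> integral {a..b} (\<lambda>x. F x * \<psi>' x) \<le> 0"
    and "\<tau> < s" "s \<le> t"
  shows "F s \<le> F t"
proof (rule ccontr)
  assume "\<not> F s \<le> F t"
  then have less: "F t < F s" and "s < t"
    using \<open>s \<le> t\<close> by (auto simp: less_le)
  define m where "m = (F s + F t) / 2"
  have "isCont F s" "isCont F t"
    using cont \<open>\<tau> < s\<close> \<open>s < t\<close> by (auto simp: continuous_on_eq_continuous_at)
  then have "(F \<longlongrightarrow> F s) (nhds s)" "(F \<longlongrightarrow> F t) (nhds t)"
    by (simp_all add: isCont_def tendsto_at_iff_tendsto_nhds)
  moreover have "m < F s" "F t < m"
    using less by (simp_all add: m_def)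
  ultimately have "\<forall>\<^sub>F x in nhds s. m < F x" "\<forall>\<^sub>F x in nhds t. F x < m"
    by (blast dest: order_tendstoD)+
  then obtain d1 d2 where d: "0 < d1" "\<And>x. dist x s < d1 \<Longrightarrow> m < F x"
    "0 < d2" "\<And>x. dist x t < d2 \<Longrightarrow> F x < m"
    by (auto simp: eventually_nhds_metric)
  \<comment> \<open>Small enough that \<open>F\<close> stays above \<open>m\<close> near
    \<open>s\<close> and below \<open>m\<close> near \<open>t\<close>, that the two bumps are
    disjoint, and that the left one stays to the right of \<open>\<tau>\<close>.\<close>
  define d where "d = Min {d1, d2, (s - \<tau>) / 2, (t - s) / 2}"
  have "0 < d"
    using d \<open>\<tau> < s\<close> \<open>s < t\<close> by (simp add: d_def)
  have "d \<le> d1" "d \<le> d2" "d \<le> (s - \<tau>) / 2" "d \<le> (t - s) / 2"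
    unfolding d_def by (rule Min.coboundedI; simp)+
  obtain \<beta> where \<beta>: "\<And>n. times_differentiable n \<beta>" "\<And>x. 0 \<le> \<beta> x" "\<And>x. 0 < \<beta> x \<longleftrightarrow> \<bar>x\<bar> < d"
    using exists_bump[OF \<open>0 < d\<close>] by blast
  have \<beta>0: "\<beta> x = 0" if "\<bar>x\<bar> \<ge> d" for x
    using \<beta>(2,3)[of x] that by linarith
  have cont\<beta>: "continuous_on S \<beta>" for S
    using times_differentiable_imp_continuous_on[OF \<beta>(1)] .
  obtain B where B: "\<And>x. (B has_real_derivative \<beta> x) (at x)"
    using exists_antiderivative[OF cont\<beta>] by blast
  have B_mono: "B x \<le> B y" if "x \<le> y" for x y
    using DERIV_nonneg_imp_nondecreasing[OF that] B \<beta>(2) by blast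
  \<comment> \<open>The bump vanishes on the whole of \<open>[x, y]\<close>. This makes
    \<open>\<psi>\<close> vanish outside \<open>{lo<..<hi}\<close>, where both shifted arguments lie
    on the same side of the bump.\<close>
  have B_const: "B x = B y" if "x \<le> y" "y \<le> - d \<or> d \<le> x" for x y
  proof -
    have "B y \<le> B x"
      using B \<beta>0 that by (intro DERIV_nonpos_imp_nonincreasing[of x y B]) fastforce+
    then show ?thesis
      using B_mono[OF that(1)] by simp
  qed
  define \<psi> where "\<psi> x = B (1 * x + (- s)) - B (1 * x + (- t))" for x
  define \<psi>' where "\<psi>' x = \<beta> (x - s) - \<beta> (x - t)" for x
  have \<psi>': "(\<psi> has_real_derivative \<psi>' x) (at x)" for x
    unfolding \<psi>_def[abs_def] \<psi>'_def
    by (rule DERIV_cong[OF DERIV_diff[OF DERIV_chain2[OF B] DERIV_chain2[OF B]]])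
       (auto intro!: derivative_eq_intros)
  define lo hi where "lo = s - d" and "hi = t + d"
  have "\<tau> < lo" "lo < hi"
    using \<open>0 < d\<close> \<open>d \<le> (s - \<tau>) / 2\<close> \<open>\<tau> < s\<close> \<open>s < t\<close> by (simp_all add: lo_def hi_def)
  have "times_differentiable (Suc n) \<psi>" for n
    unfolding \<psi>_def[abs_def]
    by (intro times_differentiable_diff times_differentiable_affine times_differentiable_SucI[OF B] \<beta>)
  then have smooth: "times_differentiable n \<psi>" for n
    by (blast intro: times_differentiable_Suc_imp)
  have supp: "\<psi> x = 0" if "x \<notin> {lo<..<hi}" for x
    using that B_const[of "x - t" "x - s"] \<open>s < t\<close> by (auto simp: \<psi>_def lo_def hi_def)
  have le0: "integral {lo..hi} (\<lambda>x. F x * \<psi>' x) \<le> 0"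
    using \<open>s < t\<close> by (intro weak[OF smooth _ \<psi>' \<open>\<tau> < lo\<close> \<open>lo < hi\<close> supp]) (auto simp: \<psi>_def intro: B_mono)
  have cont\<psi>': "continuous_on S \<psi>'" for S
    unfolding \<psi>'_def[abs_def]
    by (intro continuous_intros continuous_on_compose2[OF cont\<beta>[of UNIV]]) auto
  have contF: "continuous_on {lo..hi} F"
    using \<open>\<tau> < lo\<close> by (intro continuous_on_subset[OF cont]) auto
  have "(\<psi>' has_integral (\<psi> hi - \<psi> lo)) {lo..hi}"
    using \<open>lo < hi\<close> \<psi>' by (intro fundamental_theorem_of_calculus)
      (auto simp: has_real_derivative_iff_has_vector_derivative intro: has_vector_derivative_at_within)
  then have \<psi>'0: "(\<psi>' has_integral 0) {lo..hi}"
    by (simp add: supp)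
  \<comment> \<open>Since \<open>\<psi>'\<close> has integral zero, \<open>F\<close> may be replaced
    by \<open>F - m\<close>, which has the same sign as \<open>\<psi>'\<close> on each bump. The
    integrand is then nonnegative with integral at most zero, yet it is positive at
    \<open>s\<close>.\<close>
  have "((\<lambda>x. F x * \<psi>' x - m * \<psi>' x) has_integral integral {lo..hi} (\<lambda>x. F x * \<psi>' x) - m * 0) {lo..hi}"
    by (intro has_integral_diff has_integral_mult_right \<psi>'0 integrable_integral
        integrable_continuous_interval continuous_intros contF cont\<psi>')
  then have int: "integral {lo..hi} (\<lambda>x. (F x - m) * \<psi>' x) \<le> 0"
    using le0 by (auto simp: algebra_simps dest: integral_unique)
  have nonneg: "0 \<le> (F x - m) * \<psi>' x" for x
  proof -
    consider "\<bar>x - s\<bar> < d" | "\<bar>x - t\<bar> < d" | "d \<le> \<bar>x - s\<bar>" "d \<le> \<bar>x - t\<bar>"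
      by linarith
    then show ?thesis
    proof cases
      case 1
      then have "d \<le> \<bar>x - t\<bar>" "m < F x"
        using \<open>d \<le> (t - s) / 2\<close> \<open>d \<le> d1\<close> d(2)[of x] by (auto simp: dist_real_def)
      then show ?thesis
        using \<beta>(2)[of "x - s"] \<beta>0[of "x - t"] by (simp add: \<psi>'_def)
    next
      case 2
      then have "d \<le> \<bar>x - s\<bar>" "F x < m"
        using \<open>d \<le> (t - s) / 2\<close> \<open>d \<le> d2\<close> d(4)[of x] by (auto simp: dist_real_def)
      then show ?thesis
        using \<beta>(2)[of "x - t"] \<beta>0[of "x - s"] by (simp add: \<psi>'_def mult_nonpos_nonneg)
    qed (simp add: \<psi>'_def \<beta>0)
  qed
  have "continuous_on {lo..hi} (\<lambda>x. (F x - m) * \<psi>' x)"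
    by (intro continuous_intros contF cont\<psi>')
  moreover have "integral {lo..hi} (\<lambda>x. (F x - m) * \<psi>' x) = 0"
    using int nonneg by (intro antisym integral_nonneg integrable_continuous_interval calculation) auto
  ultimately have "\<forall>x\<in>{lo..hi}. (F x - m) * \<psi>' x = 0"
    using integral_eq_0_iff[of lo hi "\<lambda>x. (F x - m) * \<psi>' x"] \<open>lo < hi\<close> nonneg by simp
  then have "(F s - m) * \<psi>' s = 0"
    using \<open>0 < d\<close> \<open>s < t\<close> by (simp add: lo_def hi_def)
  moreover have "\<psi>' s = \<beta> 0" "0 < \<beta> 0"
    using \<beta>(3)[of 0] \<beta>0[of "s - t"] \<open>0 < d\<close> \<open>d \<le> (t - s) / 2\<close> \<open>s < t\<close> by (auto simp: \<psi>'_def)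
  ultimately show False
    using d(2)[of s] \<open>0 < d1\<close> by simp
qed

section \<open>Weak derivatives on a half-line\<close>

text \<open>On a compact interval an essentially bounded factor times a bounded one is essentially
  bounded, and the measure is finite. This gives meaning to the pairing of a weak derivative with a
  test function.\<close>

lemma Linf_loc_mult_set_integrable:
  assumes v: "Linf_loc {\<tau>..} v" and "\<tau> \<le> a" and g: "continuous_on {a..b} g"
  shows "set_integrable lebesgue {a..b} (\<lambda>t. v t * g t)"
proof -
  have sub: "{a..b} \<subseteq> {\<tau>..}"
    using \<open>\<tau> \<le> a\<close> by auto
  then obtain C where C: "AE t in lebesgue_on {a..b}. \<bar>v t\<bar> \<le> C"
    using v unfolding Linf_loc_def by blast
  obtain D where D: "\<And>t. t \<in> {a..b} \<Longrightarrow> \<bar>g t\<bar> \<le> D"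
    using compact_imp_bounded[OF compact_continuous_image[OF g compact_Icc]] 
    unfolding bounded_iff by fastforce
  have "v \<in> borel_measurable (lebesgue_on {a..b})"
    using v sub unfolding Linf_loc_def by (auto intro: measurable_restrict_mono)
  moreover have "g \<in> borel_measurable (lebesgue_on {a..b})"
    using g by (rule continuous_imp_measurable_on_sets_lebesgue) auto
  ultimately have meas: "(\<lambda>t. v t * g t) \<in> borel_measurable (lebesgue_on {a..b})"
    by (rule borel_measurable_times)
  interpret finite_measure "lebesgue_on {a..b}"
    by (rule finite_measure_lebesgue_on) auto
  have "AE t in lebesgue_on {a..b}. norm (v t * g t) \<le> C * D"
    using C AE_space
  proof eventually_elim
    case (elim t)
    then show ?case
      using D[of t] by (auto simp: abs_mult space_restrict_space intro!: mult_mono)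
  qed
  from integrable_const_bound[OF this meas] show ?thesis
    by (simp add: set_integrable_def integrable_restrict_space)
qed

lemma set_lebesgue_integral_support:
  assumes "A \<subseteq> B" "\<And>x. x \<in> B \<Longrightarrow> x \<notin> A \<Longrightarrow> f x = 0"
  shows "(LINT x:B|M. f x) = (LINT x:A|M. f x)"
  unfolding set_lebesgue_integral_def
  using assms by (intro Bochner_Integration.integral_cong) (auto simp: indicator_def)

lemma test_function_derivative:
  assumes "test_function \<Omega> \<phi>"
  shows "(\<phi> has_real_derivative deriv \<phi> x) (at x)" "continuous_on S (deriv \<phi>)"
proof -
  have diff: "(deriv ^^ n) \<phi> differentiable (at t)" for n t
    using assms by (simp add: test_function_def)
  from diff[of 0] show "(\<phi> has_real_derivative deriv \<phi> x) (at x)"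
    by (simp add: DERIV_deriv_iff_real_differentiable)
  from diff[of 1] show "continuous_on S (deriv \<phi>)"
    by (intro continuous_at_imp_continuous_on ballI differentiable_imp_continuous_within) simp
qed

text \<open>A compact subset of the open half-line keeps a positive distance from
  \<open>\<tau>\<close>, so integration can be restricted to a compact interval where solutions are
  continuous.\<close>

lemma test_function_half_line_support:
  assumes "test_function {\<tau><..} \<phi>"
  obtains a b where "\<tau> < a" "a < b" "\<And>x. x \<notin> {a<..<b} \<Longrightarrow> \<phi> x = 0"
proof (cases "{t. \<phi> t \<noteq> 0} = {}")
  case True
  then show thesis
    using that[of "\<tau> + 1" "\<tau> + 2"] by auto
next
  case False
  let ?S = "closure {t. \<phi> t \<noteq> 0}"
  have S: "compact ?S" "?S \<subseteq> {\<tau><..}" "?S \<noteq> {}"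
    using assms False by (auto simp: test_function_def)
  then obtain l u where l: "l \<in> ?S" "\<And>x. x \<in> ?S \<Longrightarrow> l \<le> x" and u: "u \<in> ?S" "\<And>x. x \<in> ?S \<Longrightarrow> x \<le> u"
    by (meson compact_attains_inf compact_attains_sup)
  have "\<tau> < l" "l \<le> u"
    using l u S(2) by auto
  \<comment> \<open>Both endpoints lie strictly outside the support, so \<open>\<phi>\<close> also
    vanishes at them and boundary terms disappear.\<close>
  have "\<phi> x = 0" if "x \<notin> {(\<tau> + l) / 2<..<u + 1}" for x
  proof (rule ccontr)
    assume "\<phi> x \<noteq> 0"
    then have "x \<in> ?S"
      using closure_subset[of "{t. \<phi> t \<noteq> 0}"] by auto
    then have "l \<le> x" "x \<le> u"
      using l(2) u(2) by blast+
    then show False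
      using that \<open>\<tau> < l\<close> by (simp add: field_simps)
  qed
  then show thesis
    using that[of "(\<tau> + l) / 2" "u + 1"] \<open>\<tau> < l\<close> \<open>l \<le> u\<close> by simp
qed

lemma test_functionI:
  assumes "\<And>n. times_differentiable n \<phi>" "\<And>x. x \<notin> {a<..<b} \<Longrightarrow> \<phi> x = 0" "{a..b} \<subseteq> \<Omega>"
  shows "test_function \<Omega> \<phi>"
proof -
  have sub: "closure {t. \<phi> t \<noteq> 0} \<subseteq> {a..b}"
  proof (rule closure_minimal)
    show "{t. \<phi> t \<noteq> 0} \<subseteq> {a..b}"
      using assms(2) greaterThanLessThan_subseteq_atLeastAtMost_iff[of a b a b] by blast
  qed simp
  moreover have "compact ({a..b} \<inter> closure {t. \<phi> t \<noteq> 0})"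
    by (intro compact_Int_closed) auto
  ultimately show ?thesis
    using assms(3) higher_deriv_differentiable[OF assms(1)]
    by (auto simp: test_function_def Int_absorb1)
qed

text \<open>Integration by parts on an interval containing the support. The finite exceptional set
  \<open>E\<close> admits functions with a kink, as the explicit solutions below have; continuity of
  \<open>u\<close> keeps jump terms away.\<close>

lemma weak_derivative_of_classical:
  assumes cont: "continuous_on {\<tau><..} u" and v: "Linf_loc {\<tau>..} v" and "finite E"
    and deriv: "\<And>x. \<tau> < x \<Longrightarrow> x \<notin> E \<Longrightarrow> (u has_real_derivative v x) (at x)"
  shows "weak_derivative {\<tau><..} u v"
  unfolding weak_derivative_def
proof (intro allI impI)
  fix \<phi> assume \<phi>: "test_function {\<tau><..} \<phi>"
  obtain a b where ab: "\<tau> < a" "a < b" and supp: "\<And>x. x \<notin> {a<..<b} \<Longrightarrow> \<phi> x = 0"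
    using test_function_half_line_support[OF \<phi>] by blast
  note D = test_function_derivative(1)[OF \<phi>]
  have supp': "deriv \<phi> x = 0" if "x \<notin> {a..b}" for x
    using has_derivative_0_outside_support[OF supp D that] .
  have contu: "continuous_on {a..b} u"
    using ab by (intro continuous_on_subset[OF cont]) auto
  have cont\<phi>: "continuous_on {a..b} \<phi>"
    using D by (intro continuous_at_imp_continuous_on) (blast intro: DERIV_isCont)
  have int1: "set_integrable lebesgue {a..b} (\<lambda>t. u t * deriv \<phi> t)"
    by (intro absolutely_integrable_continuous_real continuous_intros contu test_function_derivative(2)[OF \<phi>])
  have int2: "set_integrable lebesgue {a..b} (\<lambda>t. v t * \<phi> t)"
    using Linf_loc_mult_set_integrable[OF v _ cont\<phi>] ab by simp
  have "((\<lambda>t. v t * \<phi> t + u t * deriv \<phi> t) has_integral (u b * \<phi> b - u a * \<phi> a)) {a..b}"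
  proof (rule fundamental_theorem_of_calculus_interior_strong[OF \<open>finite E\<close>])
    fix x assume "x \<in> {a<..<b} - E"
    then show "((\<lambda>t. u t * \<phi> t) has_vector_derivative v x * \<phi> x + u x * deriv \<phi> x) (at x)"
      unfolding has_real_derivative_iff_has_vector_derivative[symmetric]
      using ab by (auto intro!: derivative_eq_intros deriv D)
  qed (use ab in \<open>auto intro!: continuous_intros contu cont\<phi>\<close>)
  then have "integral {a..b} (\<lambda>t. v t * \<phi> t + u t * deriv \<phi> t) = 0"
    by (simp add: supp integral_unique)
  then have "(LINT t:{a..b}|lebesgue. v t * \<phi> t + u t * deriv \<phi> t) = 0"
    using set_lebesgue_integral_eq_integral(2)[OF set_integral_add(1)[OF int2 int1]] by simp
  then have "(LINT t:{a..b}|lebesgue. u t * deriv \<phi> t) = - (LINT t:{a..b}|lebesgue. v t * \<phi> t)"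
    by (simp add: set_integral_add(2)[OF int2 int1])
  moreover have "(LINT t:{\<tau><..}|lebesgue. u t * deriv \<phi> t) = (LINT t:{a..b}|lebesgue. u t * deriv \<phi> t)"
    "(LINT t:{\<tau><..}|lebesgue. v t * \<phi> t) = (LINT t:{a..b}|lebesgue. v t * \<phi> t)"
    using ab by (auto intro!: set_lebesgue_integral_support simp: supp' supp)
  ultimately show "(LINT t:{\<tau><..}|lebesgue. u t * deriv \<phi> t) = - (LINT t:{\<tau><..}|lebesgue. v t * \<phi> t)"
    by simp
qed

section \<open>Solutions of the differential inclusion\<close>

lemma H0_uminus: "h \<in> H0 x \<Longrightarrow> - h \<in> H0 (- x)"
  by (auto simp: H0_def split: if_splits)

lemma H0_bound: "h \<in> H0 x \<Longrightarrow> \<bar>h\<bar> \<le> 1"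
  by (auto simp: H0_def split: if_splits)

lemma Linf_loc_uminus: "Linf_loc S v \<Longrightarrow> Linf_loc S (\<lambda>x. - v x)"
  by (simp add: Linf_loc_def)

lemma weak_derivative_uminus: "weak_derivative \<Omega> u v \<Longrightarrow> weak_derivative \<Omega> (\<lambda>x. - u x) (\<lambda>x. - v x)"
  by (simp add: weak_derivative_def set_lebesgue_integral_def)

lemma solutionsI:
  assumes "continuous_on {\<tau>..} u" "Linf_loc {\<tau>..} v" "weak_derivative {\<tau><..} u v" "Linf_loc {\<tau>..} h"
    and "AE t in lebesgue_on {\<tau>..}. h t \<in> H0 (u t) \<and> v t + lam * u t = b t * h t"
  shows "u \<in> solutions lam b \<tau>"
  using assms unfolding solutions_def by blast

text \<open>\<open>H0\<close> is odd. Thus every one-sided estimate for solutions yields the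
  opposite one, and constructing nonnegative solutions is enough.\<close>

lemma solutions_uminus:
  assumes "u \<in> solutions lam b \<tau>"
  shows "(\<lambda>x. - u x) \<in> solutions lam b \<tau>"
proof -
  obtain v h where cont: "continuous_on {\<tau>..} u"
    and v: "Linf_loc {\<tau>..} v" "weak_derivative {\<tau><..} u v" and h: "Linf_loc {\<tau>..} h"
    and ode: "AE t in lebesgue_on {\<tau>..}. h t \<in> H0 (u t) \<and> v t + lam * u t = b t * h t"
    using assms by (auto simp: solutions_def)
  have "AE t in lebesgue_on {\<tau>..}. - h t \<in> H0 (- u t) \<and> - v t + lam * (- u t) = b t * (- h t)"
    using ode by eventually_elim (auto intro: H0_uminus)
  then show ?thesis
    by (intro solutionsI[OF _ Linf_loc_uminus[OF v(1)] weak_derivative_uminus[OF v(2)] Linf_loc_uminus[OF h]]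
        continuous_intros cont)
qed

text \<open>Formally the derivative is \<open>exp (lam * x) * b x * (h x + 1)\<close>, which is
  nonnegative because \<open>h\<close> is at least \<open>-1\<close>. As \<open>u\<close> has only a
  weak derivative, the argument is carried out against test functions.\<close>

lemma solution_weighted_nondecreasing:
  assumes u: "u \<in> solutions lam b \<tau>" and b: "\<And>x. 0 \<le> b x" and contb: "continuous_on UNIV b"
    and G: "\<And>x. (G has_real_derivative exp (lam * x) * b x) (at x)"
    and "\<tau> < s" "s \<le> t"
  shows "exp (lam * s) * u s + G s \<le> exp (lam * t) * u t + G t"
proof (rule weakly_nondecreasing_imp_nondecreasing[OF _ _ \<open>\<tau> < s\<close> \<open>s \<le> t\<close>])
  obtain v h where cont: "continuous_on {\<tau>..} u"
    and v: "Linf_loc {\<tau>..} v" "weak_derivative {\<tau><..} u v"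
    and ode: "AE t in lebesgue_on {\<tau>..}. h t \<in> H0 (u t) \<and> v t + lam * u t = b t * h t"
    using u by (auto simp: solutions_def)
  have contG: "continuous_on S G" for S
    using G by (intro continuous_at_imp_continuous_on) (blast intro: DERIV_isCont)
  have cont': "continuous_on {\<tau><..} u"
    by (rule continuous_on_subset[OF cont]) auto
  then show "continuous_on {\<tau><..} (\<lambda>x. exp (lam * x) * u x + G x)"
    by (intro continuous_intros contG)
  fix \<psi> \<psi>' :: "real \<Rightarrow> real" and lo hi :: real
  assume smooth: "\<And>n. times_differentiable n \<psi>" and nonneg: "\<And>x. 0 \<le> \<psi> x"
    and \<psi>': "\<And>x. (\<psi> has_real_derivative \<psi>' x) (at x)" and "\<tau> < lo" "lo < hi"
    and supp: "\<And>x. x \<notin> {lo<..<hi} \<Longrightarrow> \<psi> x = 0"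
  let ?I = "{lo..hi}"
  \<comment> \<open>The weight turns \<open>- v * \<phi> - u * deriv \<phi>\<close> into \<open>- exp (lam * x) * (b * h * \<psi> + u * \<psi>')\<close>.\<close>
  define \<phi> where "\<phi> x = exp (lam * x) * \<psi> x" for x
  have test: "test_function {\<tau><..} \<phi>"
    unfolding \<phi>_def[abs_def] using \<open>\<tau> < lo\<close> supp
    by (intro test_functionI[of _ lo hi] times_differentiable_mult times_differentiable_exp smooth) auto
  have "(\<phi> has_real_derivative exp (lam * x) * (lam * \<psi> x + \<psi>' x)) (at x)" for x
    unfolding \<phi>_def[abs_def] by (auto intro!: derivative_eq_intros \<psi>' simp: algebra_simps)
  then have deriv\<phi>: "deriv \<phi> x = exp (lam * x) * (lam * \<psi> x + \<psi>' x)" for x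
    by (rule DERIV_imp_deriv)
  have supp\<phi>: "\<phi> x = 0" if "x \<notin> {lo<..<hi}" for x
    using supp[OF that] by (simp add: \<phi>_def)
  have supp': "deriv \<phi> x = 0" if "x \<notin> ?I" for x
    using has_derivative_0_outside_support[OF supp\<phi> test_function_derivative(1)[OF test] that] .
  have contu: "continuous_on ?I u"
    using \<open>\<tau> < lo\<close> by (intro continuous_on_subset[OF cont]) auto
  have cont\<psi>: "continuous_on S \<psi>" for S
    using times_differentiable_imp_continuous_on[OF smooth] .
  \<comment> \<open>\<open>\<psi>'\<close> is known only as a pointwise derivative. Uniqueness
    identifies it with a witness that is itself differentiable, hence continuous.\<close>
  obtain \<psi>'' where \<psi>'': "\<And>x. (\<psi> has_real_derivative \<psi>'' x) (at x)" "times_differentiable (Suc 0) \<psi>''"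
    using smooth[of "Suc (Suc 0)"] by (metis times_differentiable.simps(2))
  have "\<psi>' = \<psi>''"
    using DERIV_unique[OF \<psi>' \<psi>''(1)] by (intro ext)
  then have cont\<psi>': "continuous_on S \<psi>'" for S
    using times_differentiable_imp_continuous_on[OF \<psi>''(2)] by simp
  have cont\<phi>: "continuous_on S \<phi>" for S
    unfolding \<phi>_def[abs_def] by (intro continuous_intros cont\<psi>)
  have contb': "continuous_on S b" for S
    using contb by (rule continuous_on_subset) simp
  have int1: "set_integrable lebesgue ?I (\<lambda>t. u t * deriv \<phi> t)"
    by (intro absolutely_integrable_continuous_real continuous_intros contu test_function_derivative(2)[OF test])
  have int2: "set_integrable lebesgue ?I (\<lambda>t. v t * \<phi> t)"
    using Linf_loc_mult_set_integrable[OF v(1) _ cont\<phi>] \<open>\<tau> < lo\<close> by simp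
  \<comment> \<open>This is the integrand after \<open>h\<close> is replaced by its least value
    \<open>-1\<close>. It lies almost everywhere below
    \<open>v t * \<phi> t + u t * deriv \<phi> t\<close>, whose integral is zero.\<close>
  define f where "f x = exp (lam * x) * u x * \<psi>' x - exp (lam * x) * b x * \<psi> x" for x
  have contf: "continuous_on ?I f"
    unfolding f_def[abs_def] by (intro continuous_intros contu cont\<psi> cont\<psi>' contb')
  have intf: "set_integrable lebesgue ?I f"
    by (rule absolutely_integrable_continuous_real[OF contf])
  have "(LINT t:{\<tau><..}|lebesgue. u t * deriv \<phi> t) = - (LINT t:{\<tau><..}|lebesgue. v t * \<phi> t)"
    using v(2) test by (simp add: weak_derivative_def)
  moreover have "(LINT t:{\<tau><..}|lebesgue. u t * deriv \<phi> t) = (LINT t:?I|lebesgue. u t * deriv \<phi> t)"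
    "(LINT t:{\<tau><..}|lebesgue. v t * \<phi> t) = (LINT t:?I|lebesgue. v t * \<phi> t)"
    using \<open>\<tau> < lo\<close> by (auto intro!: set_lebesgue_integral_support simp: supp' supp\<phi>)
  ultimately have "(LINT t:?I|lebesgue. v t * \<phi> t + u t * deriv \<phi> t) = 0"
    by (simp add: set_integral_add(2)[OF int2 int1])
  moreover have "(LINT t:?I|lebesgue. f t) \<le> (LINT t:?I|lebesgue. v t * \<phi> t + u t * deriv \<phi> t)"
  proof (rule set_integral_mono_AE[OF intf set_integral_add(1)[OF int2 int1]])
    have "AE t in lebesgue. t \<in> {\<tau>..} \<longrightarrow> h t \<in> H0 (u t) \<and> v t + lam * u t = b t * h t"
      by (intro AE_restrict_space_iff[THEN iffD1, OF _ ode]) simp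
    then show "AE t\<in>?I in lebesgue. f t \<le> v t * \<phi> t + u t * deriv \<phi> t"
    proof eventually_elim
      case (elim t)
      show ?case
      proof
        assume "t \<in> ?I"
        then have h: "\<bar>h t\<bar> \<le> 1" and eq: "v t = b t * h t - lam * u t"
          using elim \<open>\<tau> < lo\<close> H0_bound by auto
        have "v t * \<phi> t + u t * deriv \<phi> t - f t = exp (lam * t) * b t * \<psi> t * (h t + 1)"
          by (simp add: eq f_def deriv\<phi> \<phi>_def algebra_simps)
        also have "\<dots> \<ge> 0"
          using h b nonneg by (intro mult_nonneg_nonneg) auto
        finally show "f t \<le> v t * \<phi> t + u t * deriv \<phi> t"
          by simp
      qed
    qed
  qed
  ultimately have f_le: "integral ?I f \<le> 0"
    by (simp add: set_lebesgue_integral_eq_integral(2)[OF intf])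
  \<comment> \<open>Integrating the derivative of \<open>G * \<psi>\<close> gives zero; adding this
    to \<open>f\<close> trades the term with \<open>b\<close> for
    \<open>G * \<psi>'\<close>.\<close>
  have "((\<lambda>x. exp (lam * x) * b x * \<psi> x + G x * \<psi>' x) has_integral (G hi * \<psi> hi - G lo * \<psi> lo)) ?I"
  proof (rule fundamental_theorem_of_calculus)
    fix x
    show "((\<lambda>x. G x * \<psi> x) has_vector_derivative exp (lam * x) * b x * \<psi> x + G x * \<psi>' x) (at x within ?I)"
      unfolding has_real_derivative_iff_has_vector_derivative[symmetric]
      by (rule DERIV_subset[where s = UNIV]) (auto intro!: derivative_eq_intros G \<psi>')
  qed (use \<open>lo < hi\<close> in simp)
  then have "((\<lambda>x. exp (lam * x) * b x * \<psi> x + G x * \<psi>' x) has_integral 0) ?I"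
    by (simp add: supp)
  from has_integral_add[OF integrable_integral[OF integrable_continuous_interval[OF contf]] this]
  have "((\<lambda>x. (exp (lam * x) * u x + G x) * \<psi>' x) has_integral integral ?I f) ?I"
    by (simp add: f_def algebra_simps)
  then show "integral ?I (\<lambda>x. (exp (lam * x) * u x + G x) * \<psi>' x) \<le> 0"
    using f_le by (simp add: integral_unique)
qed

text \<open>Test functions see only the open half-line, so monotonicity starts after
  \<open>\<tau>\<close>. Continuity of the solution from the right carries it to the initial
  time.\<close>

lemma solution_lower_bound:
  assumes u: "u \<in> solutions lam b \<tau>" and b: "\<And>x. 0 \<le> b x" and contb: "continuous_on UNIV b"
    and G: "\<And>x. (G has_real_derivative exp (lam * x) * b x) (at x)"
    and "\<tau> \<le> t"
  shows "exp (lam * \<tau>) * u \<tau> + G \<tau> \<le> exp (lam * t) * u t + G t"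
proof (cases "\<tau> = t")
  case False
  then have "\<tau> < t"
    using \<open>\<tau> \<le> t\<close> by simp
  let ?F = "\<lambda>x. exp (lam * x) * u x + G x"
  have "continuous_on {\<tau>..t} ?F"
    using u G by (intro continuous_intros continuous_at_imp_continuous_on[of _ G])
      (auto simp: solutions_def intro: continuous_on_subset DERIV_isCont)
  then have "(?F \<longlongrightarrow> ?F \<tau>) (at_right \<tau>)"
    using \<open>\<tau> < t\<close> by (rule continuous_on_Icc_at_rightD)
  moreover have "\<forall>\<^sub>F s in at_right \<tau>. ?F s \<le> ?F t"
    unfolding eventually_at_right[OF \<open>\<tau> < t\<close>]
    using \<open>\<tau> < t\<close> solution_weighted_nondecreasing[OF u b contb G] by (intro exI[of _ t]) simp
  ultimately show ?thesis
    by (rule tendsto_upperbound) simp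
qed simp

text \<open>The lower bound is applied to both \<open>u\<close> and \<open>- u\<close>.\<close>

lemma solution_abs_bound:
  assumes u: "u \<in> solutions lam b \<tau>" and b: "\<And>x. 0 \<le> b x" and contb: "continuous_on UNIV b"
    and G: "\<And>x. (G has_real_derivative exp (lam * x) * b x) (at x)"
    and "\<tau> \<le> t"
  shows "exp (lam * t) * \<bar>u t\<bar> \<le> exp (lam * \<tau>) * \<bar>u \<tau>\<bar> + (G t - G \<tau>)"
proof -
  have "exp (lam * \<tau>) * u \<tau> \<le> exp (lam * \<tau>) * \<bar>u \<tau>\<bar>"
    "exp (lam * \<tau>) * - u \<tau> \<le> exp (lam * \<tau>) * \<bar>u \<tau>\<bar>"
    by (intro mult_left_mono; simp)+
  then have "- (exp (lam * t) * u t) \<le> exp (lam * \<tau>) * \<bar>u \<tau>\<bar> + (G t - G \<tau>)"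
    "exp (lam * t) * u t \<le> exp (lam * \<tau>) * \<bar>u \<tau>\<bar> + (G t - G \<tau>)"
    using solution_lower_bound[OF u b contb G \<open>\<tau> \<le> t\<close>]
      solution_lower_bound[OF solutions_uminus[OF u] b contb G \<open>\<tau> \<le> t\<close>]
    unfolding mult_minus_right by linarith+
  then show ?thesis
    by (cases "0 \<le> u t") simp_all
qed

section \<open>Explicit solutions that leave zero at a prescribed time\<close>

lemma Linf_loc_if:
  fixes f :: "real \<Rightarrow> real"
  assumes f: "continuous_on UNIV f"
  shows "Linf_loc S (\<lambda>x. if x \<le> r then 0 else f x)"
  unfolding Linf_loc_def
proof (intro conjI allI impI)
  have "f \<in> borel_measurable borel"
    using f by (rule borel_measurable_continuous_onI)
  then have "(\<lambda>x. if x \<le> r then 0 else f x) \<in> borel_measurable borel"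
    by measurable
  then show "(\<lambda>x. if x \<le> r then 0 else f x) \<in> borel_measurable (lebesgue_on S)"
    by (intro measurable_restrict_space1 measurable_completion) simp
next
  fix K assume K: "compact K \<and> K \<subseteq> S"
  have "compact (f ` K)"
    using K by (intro compact_continuous_image continuous_on_subset[OF f]) auto
  then obtain C where "0 < C" "\<forall>y\<in>f ` K. norm y \<le> C"
    using compact_imp_bounded bounded_pos by blast
  then show "\<exists>C. AE t in lebesgue_on K. \<bar>if t \<le> r then 0 else f t\<bar> \<le> C"
    by (intro exI[of _ C] AE_I2) (simp add: space_restrict_space)
qed

text \<open>Resting at zero is allowed because \<open>0\<close> belongs to \<open>H0 0\<close>.
  After time \<open>r\<close> the function is the variation-of-constants solution of the linear
  equation with \<open>h = 1\<close> and value zero at \<open>r\<close>.\<close>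

lemma delayed_solution:
  fixes lam :: real
  assumes b: "\<And>x. 0 < b x" and contb: "continuous_on UNIV b"
    and G: "\<And>x. (G has_real_derivative exp (lam * x) * b x) (at x)"
  shows "(\<lambda>x. if x \<le> r then 0 else exp (- lam * x) * (G x - G r)) \<in> solutions lam b \<tau>"
proof -
  define w where "w x = exp (- lam * x) * (G x - G r)" for x
  define u where "u x = (if x \<le> r then 0 else w x)" for x
  define v where "v x = (if x \<le> r then 0 else b x - lam * w x)" for x
  define h where "h x = (if x \<le> r then 0 else 1 :: real)" for x
  have w': "(w has_real_derivative b x - lam * w x) (at x)" for x
    unfolding w_def[abs_def]
    by (auto intro!: derivative_eq_intros G simp: algebra_simps exp_minus)
  then have contw: "continuous_on S w" for S
    by (intro continuous_at_imp_continuous_on) (blast intro: DERIV_isCont)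
  have contu: "continuous_on S u" for S
  proof -
    have "continuous_on ({..r} \<union> {r..}) u"
      unfolding u_def[abs_def]
      by (intro continuous_on_If contw) (auto simp: w_def)
    then show ?thesis
      by (rule continuous_on_subset) auto
  qed
  have v: "Linf_loc {\<tau>..} v"
    unfolding v_def[abs_def] by (intro Linf_loc_if continuous_intros contb contw)
  have h: "Linf_loc {\<tau>..} h"
    unfolding h_def[abs_def] by (intro Linf_loc_if continuous_intros)
  have "(u has_real_derivative v x) (at x)" if "x \<noteq> r" for x
  proof (cases "x < r")
    case True
    have "((\<lambda>_. 0) has_real_derivative v x) (at x)"
      using True by (simp add: v_def)
    then show ?thesis
      by (rule has_field_derivative_transform_within_open[where S = "{..<r}"])
         (use True in \<open>auto simp: u_def\<close>)
  next
    case False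
    then have "(w has_real_derivative v x) (at x)"
      using w'[of x] that by (simp add: v_def)
    then show ?thesis
      by (rule has_field_derivative_transform_within_open[where S = "{r<..}"])
         (use False that in \<open>auto simp: u_def\<close>)
  qed
  then have weak: "weak_derivative {\<tau><..} u v"
    by (intro weak_derivative_of_classical[where E = "{r}"] contu v) auto
  \<comment> \<open>Strict positivity of \<open>b\<close> makes the function positive right after
    \<open>r\<close>, where \<open>H0\<close> is the singleton \<open>{1}\<close> that the choice of
    \<open>h\<close> requires.\<close>
  have "G r < G x" if "r < x" for x
    using that G b by (intro DERIV_pos_imp_increasing[of r x G]) (auto intro!: exI mult_pos_pos)
  then have "0 < w x" if "r < x" for x
    using that by (simp add: w_def)
  then have "h x \<in> H0 (u x) \<and> v x + lam * u x = b x * h x" for x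
    by (auto simp: h_def H0_def u_def v_def)
  then have "u \<in> solutions lam b \<tau>"
    by (intro solutionsI[OF contu v weak h] AE_I2)
  then show ?thesis
    by (simp only: u_def[abs_def] w_def)
qed

text \<open>The departure time \<open>r\<close> is chosen by the intermediate value theorem for
  \<open>G\<close> so that the delayed solution has value \<open>\<bar>z\<bar>\<close> at
  \<open>t\<close>. Since \<open>s \<le> t0 \<le> r\<close>, it is still zero at \<open>s\<close>;
  reflection covers negative \<open>z\<close>.\<close>

lemma process_zero_contains:
  assumes b: "\<And>x. 0 < b x" and contb: "continuous_on UNIV b"
    and G: "\<And>x. (G has_real_derivative exp (lam * x) * b x) (at x)"
    and "s \<le> t0" "t0 \<le> t" and z: "exp (lam * t) * \<bar>z\<bar> \<le> G t - G t0"
  shows "z \<in> process lam b t s 0"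
proof -
  have "continuous_on {t0..t} G"
    using G by (intro continuous_at_imp_continuous_on) (blast intro: DERIV_isCont)
  then obtain r where r: "t0 \<le> r" "r \<le> t" "G r = G t - exp (lam * t) * \<bar>z\<bar>"
    using IVT'[of G t0 "G t - exp (lam * t) * \<bar>z\<bar>" t] z \<open>t0 \<le> t\<close> by auto
  define u where "u x = (if x \<le> r then 0 else exp (- lam * x) * (G x - G r))" for x
  have u: "u \<in> solutions lam b s"
    unfolding u_def[abs_def] by (rule delayed_solution[OF b contb G])
  have "u s = 0"
    using r \<open>s \<le> t0\<close> by (simp add: u_def)
  have "u t = exp (- lam * t) * (G t - G r)"
    using r(2) by (simp add: u_def)
  also have "\<dots> = \<bar>z\<bar>"
    unfolding r(3) by (simp add: exp_minus)
  finally have "u t = \<bar>z\<bar>" .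
  show ?thesis
  proof (cases "0 \<le> z")
    case True
    then have "z = u t"
      using \<open>u t = \<bar>z\<bar>\<close> by simp
    then show ?thesis
      using u \<open>u s = 0\<close> unfolding process_def by blast
  next
    case False
    then have "z = - u t" "- u s = 0"
      using \<open>u t = \<bar>z\<bar>\<close> \<open>u s = 0\<close> by simp_all
    then show ?thesis
      using solutions_uminus[OF u] unfolding process_def by (intro CollectI exI[of _ "\<lambda>x. - u x"]) simp
  qed
qed

section \<open>Attraction\<close>

text \<open>The distance from \<open>z\<close> to \<open>K t\<close> does not depend on
  \<open>s\<close> and is bounded by a semidistance tending to zero as \<open>s\<close> decreases,
  so it vanishes; closedness does the rest.\<close>

lemma pullback_attracting_contains:
  assumes "pullback_attracting U K" "closed (K t)" "bounded B"
    and z: "\<And>s. s \<le> t0 \<Longrightarrow> z \<in> process_set U t s B"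
  shows "z \<in> K t"
proof -
  have lim: "((\<lambda>s. semidist (process_set U t s B) (K t)) \<longlongrightarrow> 0) at_bot"
    using assms by (simp add: pullback_attracting_def)
  have "\<forall>\<^sub>F s in at_bot. (INF x\<in>K t. ennreal \<bar>z - x\<bar>) \<le> semidist (process_set U t s B) (K t)"
    using eventually_le_at_bot[of t0] unfolding semidist_def
    by eventually_elim (rule SUP_upper2[OF z], auto)
  then have INF0: "(INF x\<in>K t. ennreal \<bar>z - x\<bar>) \<le> 0"
    by (intro tendsto_lowerbound[OF lim]) auto
  have "\<exists>x\<in>K t. dist x z < e" if "0 < e" for e
  proof -
    have "(INF x\<in>K t. ennreal \<bar>z - x\<bar>) < ennreal e"
      using INF0 that by (simp add: order.strict_trans1)
    then show ?thesis
      by (auto simp: INF_less_iff dist_real_def ennreal_less_iff abs_minus_commute)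
  qed
  then show ?thesis
    using \<open>closed (K t)\<close> closed_approachable by blast
qed

text \<open>Only the decaying contribution of the initial value can separate \<open>U t t0 B\<close>
  from the points of \<open>K t\<close> reachable from zero, and it is bounded uniformly over
  \<open>B\<close>.\<close>

lemma pullback_attracting_imp_forward_attracting:
  fixes lam :: real
  assumes "0 < lam" and contb: "continuous_on UNIV b" and b: "\<And>x. 0 < b x"
    and K: "pullback_attracting (process lam b) K" "\<And>t. closed (K t)"
  shows "forward_attracting (process lam b) K"
  unfolding forward_attracting_def
proof (intro allI impI)
  fix B :: "real set" and t0 :: real
  assume "bounded B"
  then obtain R where R: "\<And>x. x \<in> B \<Longrightarrow> \<bar>x\<bar> \<le> R"
    by (auto simp: bounded_iff)
  have "continuous_on UNIV (\<lambda>x. exp (lam * x) * b x)"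
    by (intro continuous_intros contb)
  then obtain G where G: "\<And>x. (G has_real_derivative exp (lam * x) * b x) (at x)"
    using exists_antiderivative by blast
  have bound: "semidist (process_set (process lam b) t t0 B) (K t) \<le> ennreal (exp (lam * (t0 - t)) * R)"
    if "t0 \<le> t" for t
    unfolding semidist_def
  proof (rule SUP_least)
    fix y assume "y \<in> process_set (process lam b) t t0 B"
    then obtain u where u: "u \<in> solutions lam b t0" "u t0 \<in> B" "y = u t"
      by (auto simp: process_set_def process_def)
    \<comment> \<open>The largest absolute value reachable at \<open>t\<close> by a solution that is
      zero at \<open>t0\<close>.\<close>
    define J where "J = exp (- lam * t) * (G t - G t0)"
    have GJ: "exp (lam * t) * J = G t - G t0"
      by (simp add: J_def exp_minus)
    have "G t0 \<le> G t"
      using that G b by (intro DERIV_nonneg_imp_nondecreasing[of t0 t G])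
        (auto intro!: exI mult_nonneg_nonneg less_imp_le[OF b])
    then have "0 \<le> J"
      by (simp add: J_def)
    \<comment> \<open>The projection of \<open>y\<close> onto \<open>[- J, J]\<close>. It is reached
      from zero started at any time up to \<open>t0\<close>, hence it belongs to \<open>K t\<close>
      and bounds the infimum.\<close>
    define z where "z = max (- J) (min J y)"
    have "\<bar>z\<bar> \<le> J"
      using \<open>0 \<le> J\<close> by (auto simp: z_def)
    then have "exp (lam * t) * \<bar>z\<bar> \<le> G t - G t0"
      unfolding GJ[symmetric] by simp
    then have "z \<in> process_set (process lam b) t s {0}" if "s \<le> t0" for s
      using process_zero_contains[OF b contb G that \<open>t0 \<le> t\<close>] by (simp add: process_set_def)
    moreover have "bounded {0 :: real}"
      by simp
    ultimately have "z \<in> K t"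
      by (rule pullback_attracting_contains[OF K, rotated])
    have "exp (lam * t) * \<bar>y\<bar> \<le> exp (lam * t0) * \<bar>u t0\<bar> + exp (lam * t) * J"
      using solution_abs_bound[OF u(1) less_imp_le[OF b] contb G that] u(3) GJ by simp
    also have "\<dots> \<le> exp (lam * t0) * R + exp (lam * t) * J"
      using R[OF u(2)] by simp
    also have "\<dots> = exp (lam * t) * (exp (lam * (t0 - t)) * R + J)"
      by (simp add: algebra_simps exp_add[symmetric] flip: mult.assoc exp_add)
    finally have "\<bar>y\<bar> \<le> exp (lam * (t0 - t)) * R + J"
      by simp
    \<comment> \<open>\<open>R\<close> is nonnegative here because \<open>B\<close> contains
      \<open>u t0\<close>; for empty \<open>B\<close> its sign is unknown, but then there is no
      \<open>y\<close> to treat.\<close>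
    moreover have "0 \<le> exp (lam * (t0 - t)) * R"
      using R[OF u(2)] by (intro mult_nonneg_nonneg) auto
    ultimately have "\<bar>y - z\<bar> \<le> exp (lam * (t0 - t)) * R"
      using \<open>0 \<le> J\<close> by (auto simp: z_def max_def min_def)
    then show "(INF x\<in>K t. ennreal \<bar>y - x\<bar>) \<le> ennreal (exp (lam * (t0 - t)) * R)"
      using \<open>z \<in> K t\<close> by (intro INF_lower2[of z]) (auto intro: ennreal_leI)
  qed
  have "filterlim (\<lambda>t. lam * (- t0 + t)) at_top at_top"
    by (intro filterlim_tendsto_pos_mult_at_top[OF tendsto_const \<open>0 < lam\<close>]
        filterlim_tendsto_add_at_top[OF tendsto_const] filterlim_ident)
  then have "filterlim (\<lambda>t. lam * (t0 - t)) at_bot at_top"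
    by (simp add: filterlim_uminus_at_bot algebra_simps)
  then have "((\<lambda>t. exp (lam * (t0 - t)) * R) \<longlongrightarrow> 0) at_top"
    by (intro tendsto_mult_left_zero filterlim_compose[OF exp_at_bot])
  then have "((\<lambda>t. ennreal (exp (lam * (t0 - t)) * R)) \<longlongrightarrow> 0) at_top"
    using tendsto_ennrealI by fastforce
  then show "((\<lambda>t. semidist (process_set (process lam b) t t0 B) (K t)) \<longlongrightarrow> 0) at_top"
    by (rule tendsto_sandwich[OF _ _ tendsto_const, rotated 2])
       (auto intro: eventually_mono[OF eventually_ge_at_top[of t0] bound])
qed

text \<open>The two notions of attractor share non-emptiness, compactness and negative invariance,
  so only the mode of attraction has to be converted.\<close>

theorem theorem36:
  fixes lam b0 b1 :: real and b :: "real \<Rightarrow> real" and A :: "real \<Rightarrow> real set"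
  assumes "lam > 0"
    and "continuous_on UNIV b"
    and "0 < b0"
    and "\<And>t. b0 \<le> b t \<and> b t \<le> b1"
    and "pullback_attractor (process lam b) A"
  shows "forward_attractor (process lam b) A"
proof -
  have "0 < b t" for t
    using assms(3) assms(4)[of t] by linarith
  then have "forward_attracting (process lam b) A"
    using assms(1,2,5) unfolding pullback_attractor_def
    by (intro pullback_attracting_imp_forward_attracting) (auto intro: compact_imp_closed)
  then show ?thesis
    using assms(5) by (simp add: pullback_attractor_def forward_attractor_def)
qed

end
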